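(* Let $q$ be an even positive integer, let $N\in\mathbb{N}$, and put $M:=\binom{N+q-1}{q}$. There exist a discrete set $\Omega_M$ consisting of $M$ distinct points, equipped with the uniform probability measure $\mu$ (each point has mass $1/M$), and an $N$-dimensional real linear subspace $X_N\subset L_q(\Omega_M,\mu)$ of real-valued functions on $\Omega_M$ such that for every $m<M$ there do not exist points $\xi^1,\dots,\xi^m\in\Omega_M$ and real numbers $\lambda_1,\dots,\lambda_m$ satisfying $$\int_{\Omega_M}|f|^q\,d\mu=\sum_{\nu=1}^m\lambda_\nu|f(\xi^\nu)|^q\qquad\text{for all } f\in X_N .$$
   Context: The weights $\lambda_\nu$ are allowed to have any sign and the nodes need not be distinct. In the paper's notation, the non-existence statement is written $X_N\notin\mathcal{M}^w(m,q,0)$ for any $m<M$. *)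

theory Defs
  imports "HOL-Analysis.Analysis" "HOL-Library.Function_Algebras"
begin

text \<open>
  The library does not make the function space a member of the class
  \<^class>\<open>real_vector\<close>, so the real vector space of functions under the
  pointwise operations is set up through the library locale \<open>vector_space\<close>.
\<close>

definition fun_scale :: "real \<Rightarrow> ('a \<Rightarrow> real) \<Rightarrow> 'a \<Rightarrow> real"
  where "fun_scale c f = (\<lambda>x. c * f x)"

interpretation fun_space: vector_space "fun_scale :: real \<Rightarrow> ('a \<Rightarrow> real) \<Rightarrow> 'a \<Rightarrow> real"
  by unfold_locales (auto simp: fun_scale_def fun_eq_iff algebra_simps)

text \<open>
  Functions on \<open>space M\<close> are represented by total functions that vanish off
  \<open>space M\<close>; without this normalisation the values off \<open>space M\<close> would
  contribute to the dimension of a space of functions. Functions that agree almost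
  everywhere are not identified; when all points have positive mass, as in a uniform
  measure on a finite set, there is nothing to identify.
\<close>

definition Lq_space :: "nat \<Rightarrow> 'a measure \<Rightarrow> ('a \<Rightarrow> real) set"
  where "Lq_space q M = {f \<in> borel_measurable M.
    integrable M (\<lambda>x. \<bar>f x\<bar> ^ q) \<and> (\<forall>x. x \<notin> space M \<longrightarrow> f x = 0)}"

end

theory Submission
  imports Defs
begin

text \<open>
  Let \<open>\<Omega>\<close> enumerate the lattice points \<open>\<alpha> \<in> \<nat>\<^sup>N\<close> with \<open>\<Sum>\<^sub>i \<alpha>\<^sub>i = q\<close>, and let \<open>X\<close> be spanned by
  the coordinate functions. On \<open>\<Omega>\<close> the constants lie in \<open>X\<close>, because the coordinates sum to \<open>q\<close>.
  A quadrature formula with fewer than \<open>M\<close> nodes gives coefficients \<open>c\<close>, with \<open>c \<beta> = 1 / M\<close> at some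
  unused point \<open>\<beta>\<close>, such that \<open>\<Sum>\<^sub>\<alpha> c \<alpha> * f \<alpha> ^ q = 0\<close> on \<open>X\<close>. By polarization this functional kills
  every product of \<open>q\<close> elements of \<open>X\<close>, in particular \<open>\<Prod>\<^sub>i \<Prod>\<^bsub>k < \<beta>\<^sub>i\<^esub> (\<alpha>\<^sub>i - k)\<close>, which vanishes
  on \<open>\<Omega>\<close> except at \<open>\<beta>\<close>.
\<close>

section \<open>Polarization: from powers to products\<close>

lemma sum_Pow_insert:
  fixes g :: "'a set \<Rightarrow> 'b::comm_monoid_add"
  assumes "finite I" "a \<notin> I"
  shows "(\<Sum>S\<in>Pow (insert a I). g S) = (\<Sum>S\<in>Pow I. g S) + (\<Sum>S\<in>Pow I. g (insert a S))"
proof -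
  have inj: "inj_on (insert a) (Pow I)"
    using assms(2) by (intro inj_onI) (metis PowD insert_ident subsetD)
  have "(\<Sum>S\<in>Pow (insert a I). g S) = (\<Sum>S\<in>Pow I. g S) + (\<Sum>S\<in>insert a ` Pow I. g S)"
    unfolding Pow_insert using assms by (intro sum.union_disjoint) auto
  then show ?thesis
    by (simp add: sum.reindex[OF inj])
qed

text \<open>Pairing each subset \<open>S\<close> of \<open>I\<close> with \<open>insert a S\<close>
  turns the alternating sum into a finite difference, which lowers the degree in the subset sums by
  one. Exponents below \<open>card I\<close> are included because the expansion of that difference
  produces them in the induction step.\<close>

lemma alternating_subset_sum_power:
  fixes x :: "'a \<Rightarrow> 'b::comm_ring_1"
  assumes "finite I" "j \<le> card I"
  shows "(\<Sum>S\<in>Pow I. (- 1) ^ card (I - S) * (\<Sum>i\<in>S. x i) ^ j) =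
    (if j = card I then of_nat (fact j) * (\<Prod>i\<in>I. x i) else 0)"
  using assms
proof (induction I arbitrary: j rule: finite_induct)
  case empty
  then show ?case by simp
next
  case (insert a I)
  define s where "s S = (\<Sum>i\<in>S. x i)" for S
  define e :: "'a set \<Rightarrow> 'b" where "e S = (- 1) ^ card (I - S)" for S
  define P where "P = (\<Prod>i\<in>I. x i)"
  have IH: "(\<Sum>S\<in>Pow I. e S * s S ^ k) = (if k = card I then of_nat (fact k) * P else 0)"
    if "k \<le> card I" for k
    using insert.IH[OF that] by (simp add: e_def s_def P_def)
  have e1: "(- 1) ^ card (insert a I - S) * (\<Sum>i\<in>S. x i) ^ j = - (e S * s S ^ j)"
    if "S \<in> Pow I" for S
  proof -
    have "insert a I - S = insert a (I - S)" "a \<notin> I - S"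
      using that insert.hyps by auto
    then show ?thesis
      using insert.hyps by (simp add: e_def s_def)
  qed
  have e2: "(- 1) ^ card (insert a I - insert a S) * (\<Sum>i\<in>insert a S. x i) ^ j
      = e S * (s S + x a) ^ j" if "S \<in> Pow I" for S
  proof -
    have "insert a I - insert a S = I - S" "a \<notin> S" "finite S"
      using that insert.hyps finite_subset by auto
    then show ?thesis
      by (simp add: e_def s_def add.commute)
  qed
  \<comment> \<open>The term of exponent \<open>j\<close> cancels, so every remaining exponent is at
    most \<open>card I\<close> and falls under the induction hypothesis.\<close>
  have diff: "(s S + x a) ^ j - s S ^ j = (\<Sum>k<j. of_nat (j choose k) * s S ^ k * x a ^ (j - k))"
    for S
    by (simp add: binomial_ring lessThan_Suc_atMost[symmetric])
  have "(\<Sum>S\<in>Pow (insert a I). (- 1) ^ card (insert a I - S) * (\<Sum>i\<in>S. x i) ^ j)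
      = (\<Sum>S\<in>Pow I. - (e S * s S ^ j)) + (\<Sum>S\<in>Pow I. e S * (s S + x a) ^ j)"
    unfolding sum_Pow_insert[OF insert.hyps] using e1 e2
    by (auto intro!: arg_cong2[of _ _ _ _ "(+)"] sum.cong)
  also have "\<dots> = (\<Sum>S\<in>Pow I. e S * ((s S + x a) ^ j - s S ^ j))"
    by (simp add: right_diff_distrib sum_subtractf sum_negf)
  also have "\<dots> = (\<Sum>S\<in>Pow I. \<Sum>k<j. of_nat (j choose k) * x a ^ (j - k) * (e S * s S ^ k))"
    unfolding diff sum_distrib_left by (simp add: mult_ac)
  also have "\<dots> = (\<Sum>k<j. of_nat (j choose k) * x a ^ (j - k) * (\<Sum>S\<in>Pow I. e S * s S ^ k))"
    by (subst sum.swap) (simp add: sum_distrib_left)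
  also have "\<dots> = (\<Sum>k<j. if k = card I
      then of_nat (j choose k) * x a ^ (j - k) * (of_nat (fact k) * P) else 0)"
    using insert.prems insert.hyps by (intro sum.cong) (auto simp: IH)
  also have "\<dots> = (if card I < j
      then of_nat (j choose card I) * x a ^ (j - card I) * (of_nat (fact (card I)) * P) else 0)"
    by (simp add: sum.delta)
  \<comment> \<open>As \<open>j\<close> is at most \<open>card I + 1\<close>, the condition
    \<open>card I < j\<close> forces equality, and then \<open>j choose card I\<close> times
    \<open>fact (card I)\<close> is \<open>fact j\<close>.\<close>
  also have "\<dots> = (if j = card (insert a I) then of_nat (fact j) * (\<Prod>i\<in>insert a I. x i) else 0)"
    using insert.prems insert.hyps by (auto simp: P_def algebra_simps)
  finally show ?case .
qed

lemma polarization: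
  fixes x :: "'a \<Rightarrow> 'b::comm_ring_1"
  assumes "finite I"
  shows "of_nat (fact (card I)) * (\<Prod>i\<in>I. x i) =
    (\<Sum>S\<in>Pow I. (- 1) ^ card (I - S) * (\<Sum>i\<in>S. x i) ^ card I)"
  using alternating_subset_sum_power[OF assms order_refl, of x] by simp

lemma sum_fun_apply: "(\<Sum>i\<in>A. f i) x = (\<Sum>i\<in>A. f i x)"
  for f :: "'i \<Rightarrow> 'a \<Rightarrow> 'b::comm_monoid_add"
  by (induction A rule: infinite_finite_induct) auto

text \<open>Polarization writes the product as a combination of powers of subset sums, and these
  sums stay in the subspace. Indexing the factors by \<open>I\<close> allows the same function to
  occur several times.\<close>

lemma sum_prod_eq_0_if_sum_power_eq_0:
  fixes X :: "('a \<Rightarrow> real) set"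
  assumes X: "fun_space.subspace X"
    and power: "\<And>f. f \<in> X \<Longrightarrow> (\<Sum>k\<in>A. c k * f k ^ card I) = 0"
    and "finite I" and F: "\<And>i. i \<in> I \<Longrightarrow> F i \<in> X"
  shows "(\<Sum>k\<in>A. c k * (\<Prod>i\<in>I. F i k)) = 0"
proof -
  have "of_nat (fact (card I)) * (\<Sum>k\<in>A. c k * (\<Prod>i\<in>I. F i k))
      = (\<Sum>k\<in>A. c k * (of_nat (fact (card I)) * (\<Prod>i\<in>I. F i k)))"
    by (simp add: sum_distrib_left mult_ac)
  also have "\<dots> = (\<Sum>k\<in>A. \<Sum>S\<in>Pow I. (- 1) ^ card (I - S) * (c k * (\<Sum>i\<in>S. F i k) ^ card I))"
    unfolding polarization[OF \<open>finite I\<close>] sum_distrib_left by (simp add: mult_ac)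
  also have "\<dots> = (\<Sum>S\<in>Pow I. (- 1) ^ card (I - S) * (\<Sum>k\<in>A. c k * (\<Sum>i\<in>S. F i k) ^ card I))"
    by (subst sum.swap) (simp add: sum_distrib_left)
  also have "\<dots> = 0"
  proof (intro sum.neutral ballI)
    fix S assume "S \<in> Pow I"
    then have "(\<Sum>i\<in>S. F i) \<in> X"
      using F by (intro fun_space.subspace_sum[OF X]) auto
    from power[OF this]
    show "(- 1) ^ card (I - S) * (\<Sum>k\<in>A. c k * (\<Sum>i\<in>S. F i k) ^ card I) = 0"
      by (simp add: sum_fun_apply)
  qed
  finally show ?thesis by simp
qed

section \<open>Lattice points and their coordinate functions\<close>

lemma sum_list_conv_sum_lessThan: "length xs = n \<Longrightarrow> sum_list xs = (\<Sum>i<n. xs ! i)"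
  by (simp add: sum_list_sum_nth atLeast0LessThan)

text \<open>Equal totals leave no room for a strict inequality. Used in contrapositive form: of two
  distinct lattice points, each has a coordinate strictly below that of the other.\<close>

lemma list_eq_if_le_and_sum_list_eq:
  fixes xs ys :: "nat list"
  assumes "length xs = n" "length ys = n" "sum_list xs = sum_list ys"
    and le: "\<And>i. i < n \<Longrightarrow> xs ! i \<le> ys ! i"
  shows "xs = ys"
proof (rule nth_equalityI)
  fix i assume "i < length xs"
  moreover have "(\<Sum>i<n. xs ! i) = (\<Sum>i<n. ys ! i)"
    using assms by (simp add: sum_list_conv_sum_lessThan)
  ultimately show "xs ! i = ys ! i"
    using sum_mono_inv[of "\<lambda>i. xs ! i" "{..<n}" "\<lambda>i. ys ! i"] le assms(1) by auto
qed (simp add: assms)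

text \<open>The lists are the exponent vectors of the monomials of degree \<open>q\<close> in
  \<open>N\<close> variables. The bijection \<open>p\<close> lets the points themselves be of any
  type, such as natural numbers.\<close>

locale lattice_points =
  fixes q N :: nat and \<Omega> :: "'a set" and p :: "'a \<Rightarrow> nat list"
  assumes q_pos: "q > 0" and fin: "finite \<Omega>" and bij: "bij_betw p \<Omega> {l. length l = N \<and> sum_list l = q}"
begin

text \<open>The value 0 off \<Omega> is the normalisation that \<open>Lq_space\<close>
  demands.\<close>

definition coord :: "nat \<Rightarrow> 'a \<Rightarrow> real"
  where "coord i = (\<lambda>k. if k \<in> \<Omega> then real (p k ! i) else 0)"

definition X :: "('a \<Rightarrow> real) set"
  where "X = fun_space.span (coord ` {..<N})"

lemma subspace_X: "fun_space.subspace X"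
  by (simp add: X_def)

lemma coord_in_X: "i < N \<Longrightarrow> coord i \<in> X"
  unfolding X_def by (intro fun_space.span_base) auto

lemma p_length: "k \<in> \<Omega> \<Longrightarrow> length (p k) = N"
  and p_sum: "k \<in> \<Omega> \<Longrightarrow> sum_list (p k) = q"
  using bij by (auto simp: bij_betw_def)

lemma vanishes_outside: "f \<in> X \<Longrightarrow> k \<notin> \<Omega> \<Longrightarrow> f k = 0"
  unfolding X_def
  by (induction rule: fun_space.span_induct_alt) (auto simp: fun_scale_def coord_def)

lemma card_\<Omega>: "card \<Omega> = (N + q - 1) choose q"
  using bij_betw_same_card[OF bij] card_length_sum_list[of N q] by (simp add: add.commute)

lemma indicator_in_X: "indicator \<Omega> \<in> X"
proof -
  have "fun_scale (1 / real q) (\<Sum>i<N. coord i) \<in> X"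
    by (intro fun_space.subspace_scale[OF subspace_X] fun_space.subspace_sum[OF subspace_X])
      (simp add: coord_in_X)
  moreover have "fun_scale (1 / real q) (\<Sum>i<N. coord i) = indicator \<Omega>"
  proof
    fix k
    have "(\<Sum>i<N. real (p k ! i)) = real q" if "k \<in> \<Omega>"
      using p_sum[OF that] sum_list_conv_sum_lessThan[OF p_length[OF that]]
      by (metis of_nat_sum)
    then show "fun_scale (1 / real q) (\<Sum>i<N. coord i) k = indicator \<Omega> k"
      using q_pos by (cases "k \<in> \<Omega>") (simp_all add: fun_scale_def sum_fun_apply coord_def)
  qed
  ultimately show ?thesis by simp
qed

text \<open>The vertices of the simplex, \<open>q\<close> times the unit vectors, isolate single
  coordinates; evaluating there shows that the functions \<open>coord i\<close> are distinct and
  independent.\<close>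

lemma vertex:
  assumes "i < N"
  obtains v where "v \<in> \<Omega>" "\<And>j. j < N \<Longrightarrow> coord j v = (if j = i then real q else 0)"
proof -
  define l where "l = (replicate N 0)[i := q]"
  have l_nth: "l ! j = (if j = i then q else 0)" if "j < N" for j
    using that assms by (simp add: l_def nth_list_update)
  have "length l = N"
    by (simp add: l_def)
  moreover from this have "sum_list l = q"
    using assms by (simp add: sum_list_conv_sum_lessThan l_nth)
  ultimately have "l \<in> p ` \<Omega>"
    using bij by (simp add: bij_betw_def)
  then obtain v where "v \<in> \<Omega>" "p v = l"
    by auto
  then show ?thesis
    using assms by (intro that[of v]) (auto simp: coord_def l_nth)
qed

lemma dim_X: "fun_space.dim X = N"
proof -
  have inj: "inj_on coord {..<N}"
  proof (rule inj_onI)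
    fix i j assume *: "i \<in> {..<N}" "j \<in> {..<N}" "coord i = coord j"
    then obtain v where "\<And>j. j < N \<Longrightarrow> coord j v = (if j = i then real q else 0)"
      using vertex by blast
    then show "i = j"
      using * q_pos by (metis lessThan_iff of_nat_0_eq_iff less_irrefl)
  qed
  have "fun_space.independent (coord ` {..<N})"
  proof (rule fun_space.independent_if_scalars_zero)
    fix u g assume u: "(\<Sum>h\<in>coord ` {..<N}. fun_scale (u h) h) = 0" and "g \<in> coord ` {..<N}"
    then obtain i where i: "i < N" "g = coord i" by auto
    then obtain v where v: "\<And>j. j < N \<Longrightarrow> coord j v = (if j = i then real q else 0)"
      using vertex by blast
    have "0 = (\<Sum>h\<in>coord ` {..<N}. fun_scale (u h) h) v"
      by (simp add: u)
    also have "\<dots> = (\<Sum>j<N. u (coord j) * coord j v)"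
      by (simp add: sum_fun_apply sum.reindex[OF inj] fun_scale_def)
    also have "\<dots> = (\<Sum>j<N. if j = i then u (coord j) * real q else 0)"
      by (intro sum.cong) (auto simp: v)
    also have "\<dots> = u g * real q"
      using i by simp
    finally show "u g = 0"
      using q_pos by simp
  qed simp
  then show ?thesis
    unfolding X_def using card_image[OF inj]
    by (metis card_lessThan fun_space.dim_span_eq_card_independent)
qed

lemma coefficients_eq_0:
  assumes "\<And>f. f \<in> X \<Longrightarrow> (\<Sum>k\<in>\<Omega>. c k * f k ^ q) = 0" and b: "b \<in> \<Omega>"
  shows "c b = 0"
proof -
  \<comment> \<open>One index per linear factor of the product of falling factorials. Their number
    is the coordinate sum of \<open>p b\<close>, hence exactly \<open>q\<close>, as polarization
    requires.\<close>
  define I where "I = (SIGMA i:{..<N}. {..<p b ! i})"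
  define F where "F = (\<lambda>(i, k). coord i - fun_scale (real k) (indicator \<Omega>))"
  define P where "P \<alpha> = (\<Prod>ik\<in>I. F ik \<alpha>)" for \<alpha>
  have finI: "finite I"
    by (auto simp: I_def)
  have cardI: "card I = q"
    using p_sum[OF b] sum_list_conv_sum_lessThan[OF p_length[OF b]] by (simp add: I_def)
  have FX: "F ik \<in> X" if "ik \<in> I" for ik
    using that
    by (auto simp: F_def I_def intro!: fun_space.subspace_diff[OF subspace_X]
        fun_space.subspace_scale[OF subspace_X] coord_in_X indicator_in_X)
  have F_apply: "F (i, k) \<alpha> = real (p \<alpha> ! i) - real k" if "\<alpha> \<in> \<Omega>" for i k \<alpha>
    using that by (simp add: F_def coord_def fun_scale_def)
  have P_zero: "P \<alpha> = 0" if \<alpha>: "\<alpha> \<in> \<Omega>" "\<alpha> \<noteq> b" for \<alpha>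
  proof -
    have "p b \<noteq> p \<alpha>"
      using \<alpha> b bij by (auto simp: bij_betw_def inj_on_def)
    \<comment> \<open>A coordinate of \<alpha> lying below that of \<open>b\<close> is itself one of
      the subtracted values \<open>k\<close>, so its factor vanishes at \<alpha>.\<close>
    then obtain i where i: "i < N" "p \<alpha> ! i < p b ! i"
      using list_eq_if_le_and_sum_list_eq[of "p b" N "p \<alpha>"] p_length p_sum \<alpha>(1) b
      by (metis not_le)
    then have "(i, p \<alpha> ! i) \<in> I" "F (i, p \<alpha> ! i) \<alpha> = 0"
      using F_apply[OF \<alpha>(1)] by (auto simp: I_def)
    then show ?thesis
      unfolding P_def using finI by (meson prod_zero)
  qed
  \<comment> \<open>At \<open>b\<close> every factor is \<open>p b ! i - k\<close> with
    \<open>k < p b ! i\<close>.\<close>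
  have P_nonzero: "P b \<noteq> 0"
    using finI b by (auto simp: P_def I_def F_apply)
  have "0 = (\<Sum>k\<in>\<Omega>. c k * P k)"
    unfolding P_def
    by (intro sum_prod_eq_0_if_sum_power_eq_0[symmetric, OF subspace_X _ finI FX])
      (auto simp: cardI assms)
  also have "\<dots> = (\<Sum>k\<in>\<Omega>. if k = b then c b * P b else 0)"
    by (intro sum.cong) (auto simp: P_zero)
  also have "\<dots> = c b * P b"
    using fin b by simp
  finally show ?thesis
    using P_nonzero by simp
qed

section \<open>Excluding short quadrature formulas\<close>

lemma integral_power:
  assumes "even q"
  shows "(\<integral>x. \<bar>f x\<bar> ^ q \<partial>uniform_count_measure \<Omega>) = (\<Sum>k\<in>\<Omega>. f k ^ q / card \<Omega>)"
  unfolding uniform_count_measure_def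
  by (subst lebesgue_integral_point_measure_finite) (auto simp: fin assms power_even_abs)

lemma X_subset_Lq_space: "X \<subseteq> Lq_space q (uniform_count_measure \<Omega>)"
proof
  fix f assume "f \<in> X"
  then show "f \<in> Lq_space q (uniform_count_measure \<Omega>)"
    using vanishes_outside fin
    by (auto simp: Lq_space_def space_uniform_count_measure uniform_count_measure_def
        space_point_measure integrable_point_measure_finite)
qed

lemma no_short_quadrature:
  assumes "even q" and "m < card \<Omega>" and \<xi>: "\<And>\<nu>. \<nu> \<in> {1..m} \<Longrightarrow> \<xi> \<nu> \<in> \<Omega>"
    and quad: "\<And>f. f \<in> X \<Longrightarrow> (\<integral>x. \<bar>f x\<bar> ^ q \<partial>uniform_count_measure \<Omega>) =
                  (\<Sum>\<nu>=1..m. w \<nu> * \<bar>f (\<xi> \<nu>)\<bar> ^ q)"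
  shows False
proof -
  \<comment> \<open>The mass of \<open>k\<close> minus the total weight of all nodes located at
    \<open>k\<close>; summing over fibres of \<xi> accounts for repeated nodes.\<close>
  define c where "c k = 1 / card \<Omega> - (\<Sum>\<nu> | \<nu> \<in> {1..m} \<and> \<xi> \<nu> = k. w \<nu>)" for k
  have "card (\<xi> ` {1..m}) \<le> m"
    using card_image_le[of "{1..m}" \<xi>] by simp
  then have "\<not> \<Omega> \<subseteq> \<xi> ` {1..m}"
    using \<open>m < card \<Omega>\<close> by (meson card_mono finite_atLeastAtMost finite_imageI leD le_trans)
  then obtain b where b: "b \<in> \<Omega>" "b \<notin> \<xi> ` {1..m}" by blast
  have "(\<Sum>k\<in>\<Omega>. c k * f k ^ q) = 0" if "f \<in> X" for f
  proof -
    \<comment> \<open>Evenness of \<open>q\<close> removes the absolute values, leaving pure powers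
      of \<open>f\<close> to which polarization applies.\<close>
    have "(\<Sum>k\<in>\<Omega>. f k ^ q / card \<Omega>) = (\<Sum>\<nu>=1..m. w \<nu> * f (\<xi> \<nu>) ^ q)"
      using quad[OF that] unfolding integral_power[OF assms(1)] by (simp add: assms(1) power_even_abs)
    also have "\<dots> = (\<Sum>k\<in>\<Omega>. \<Sum>\<nu> | \<nu> \<in> {1..m} \<and> \<xi> \<nu> = k. w \<nu> * f (\<xi> \<nu>) ^ q)"
      using \<xi> by (intro sum.group[symmetric]) (auto simp: fin)
    also have "\<dots> = (\<Sum>k\<in>\<Omega>. (\<Sum>\<nu> | \<nu> \<in> {1..m} \<and> \<xi> \<nu> = k. w \<nu>) * f k ^ q)"
      by (intro sum.cong) (auto simp: sum_distrib_right)
    finally show ?thesis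
      by (simp add: c_def left_diff_distrib sum_subtractf)
  qed
  then have "c b = 0"
    using b(1) by (rule coefficients_eq_0)
  moreover have "{\<nu>. \<nu> \<in> {1..m} \<and> \<xi> \<nu> = b} = {}"
    using b(2) by blast
  then have "c b = 1 / card \<Omega>"
    unfolding c_def by (metis diff_zero sum.empty)
  \<comment> \<open>The bound \<open>m < card \<Omega>\<close> makes \<open>card \<Omega>\<close>
    positive, so its reciprocal is not 0.\<close>
  ultimately show False
    using \<open>m < card \<Omega>\<close> by simp
qed

end

theorem theorem3p2:
  fixes q N :: nat
  assumes "even q" and "q > 0" and "N \<ge> 1"
  shows "\<exists>(\<Omega> :: nat set) (X :: (nat \<Rightarrow> real) set).
    finite \<Omega> \<and> card \<Omega> = (N + q - 1) choose q \<and>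
    X \<subseteq> Lq_space q (uniform_count_measure \<Omega>) \<and>
    fun_space.subspace X \<and> fun_space.dim X = N \<and>
    (\<forall>m < (N + q - 1) choose q.
      \<not> (\<exists>(\<xi> :: nat \<Rightarrow> nat) (w :: nat \<Rightarrow> real).
          (\<forall>\<nu>\<in>{1..m}. \<xi> \<nu> \<in> \<Omega>) \<and>
          (\<forall>f\<in>X. (\<integral>x. \<bar>f x\<bar> ^ q \<partial>uniform_count_measure \<Omega>) =
                  (\<Sum>\<nu>=1..m. w \<nu> * \<bar>f (\<xi> \<nu>)\<bar> ^ q))))"
proof -
  define T where "T = {l :: nat list. length l = N \<and> sum_list l = q}"
  \<comment> \<open>Each entry is bounded by the sum \<open>q\<close>, so \<open>T\<close> is finite
    and can be numbered by an initial segment of the naturals, which serves as \<Omega>.\<close>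
  have "T \<subseteq> {l. set l \<subseteq> {..q} \<and> length l = N}"
    by (auto simp: T_def member_le_sum_list)
  then have "finite T"
    by (rule finite_subset) (simp add: finite_lists_length_eq)
  then obtain p where "bij_betw p {..<card T} T"
    using ex_bij_betw_nat_finite by (metis atLeast0LessThan)
  then interpret lattice_points q N "{..<card T}" p
    using assms(2) by unfold_locales (simp_all add: T_def)
  show ?thesis
    unfolding card_\<Omega>[symmetric]
    using X_subset_Lq_space subspace_X dim_X no_short_quadrature[OF assms(1)]
    by (intro exI[of _ "{..<card T}"] exI[of _ X] conjI) (blast | simp)+
qed

end
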